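(* No two-sided frieze type whose label has the symbol $\mathrm{m}$ (alone or stacked with another symbol) in the fourth position can be realised in hitomezashi. That is, none of the types $\mathrm{p11m}$, $\mathrm{p}11\stackrel{2}{\mathrm{m}}$, $\mathrm{p2mm}$, $\mathrm{pm2m}$, $\mathrm{pmmm}$, $\mathrm{p}2'\mathrm{am}$, $\mathrm{pmam}$ is the type of any hitomezashi two-sided frieze.
   Context: **Hitomezashi two-sided friezes.** Let $x=(x_i)_{i\in\mathbb Z}$ be a periodic bi-infinite binary sequence (given by indefinite repetition of a finite binary word), and let $y=y_1\cdots y_n$ be a finite binary word with $n=|y|\ge 2$. The grid edges of the strip are the vertical unit edges from $(i,j)$ to $(i,j+1)$ for $i\in\mathbb Z$, $1\le j\le n-1$, and the horizontal unit edges from $(i,j)$ to $(i+1,j)$ for $i\in\mathbb Z$, $1\le j\le n$. Stitches and gaps alternate along each line. On the front, the vertical edge from $(i,j)$ to $(i,j+1)$ carries a stitch iff ($x_i=1$ and $j$ odd) or ($x_i=0$ and $j$ even); the horizontal edge from $(i,j)$ to $(i+1,j)$ carries a stitch iff ($y_j=1$ and $i$ even) or ($y_j=0$ and $i$ odd). Let $F$ be the set of edges carrying a stitch on the front. On the back, a stitch lies behind each gap of the front and a gap behind each stitch, so the set $B$ of edges stitched on the back (in the same planar coordinates) is the complement of $F$ in the set of all grid edges. The pair $(F,B)$ is the hitomezashi two-sided frieze given by $x,y$. **Symmetries.** Axis $\mathbf a$ is the horizontal central line of the strip in the frieze plane, $\mathbf b$ is perpendicular to $\mathbf a$ in the frieze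 plane, and $\mathbf c$ is perpendicular to the frieze plane. A candidate isometry is a quadruple $(s,t,e,d)$ with $s,e,d\in\{+1,-1\}$, $t\in\mathbb R$. It acts on the plane by $X\mapsto sX+t$ on the horizontal coordinate, fixes the vertical coordinate if $e=+1$, sends it to $Y\mapsto n+1-Y$ if $e=-1$, and keeps the two sides if $d=+1$ or exchanges them if $d=-1$. It is a symmetry of $(F,B)$ if its planar action maps $F$ to $F$ and $B$ to $B$ (case $d=+1$), or $F$ to $B$ and $B$ to $F$ (case $d=-1$). The symmetries form a group $G$, whose pure translations $(+1,t,+1,+1)$ are those with $t\in T\mathbb Z$ for some $T>0$. **Labels.** A two-sided frieze type has a label $\mathrm{p}\ast\ast\ast$ whose second, third and fourth positions describe symmetry relative to $\mathbf a$, $\mathbf b$, $\mathbf c$ respectively. Symbols: $1$ is a placeholder; $\mathrm m$ is reflection in a plane perpendicular to the axis; $\mathrm a$ is glide reflection, the reflection being in a plane perpendicular to the axis and the glide parallel to $\mathbf a$; $2$ is rotation by $180^\circ$ about the axis (for $\mathbf b$, $\mathbf c$: about some line parallel to it meeting $\mathbf a$); $2'$ (second position only) is a screw, i.e. $180^\circ$ rotation about $\mathbf a$ together with a translation parallel to $\mathbf a$; $\tilde 2$ (fourth position only) is roto-reflection, i.e. $180^\circ$ rotation about a line parallel to $\mathbf c$ together with reflection in the frieze plane. Two symbols applying to the same axis are stacked. In terms of quadruples, the symbols in the various positions are: second position: $\mathrm m=(-1,t,+,+)$, $2=(+1,0,-,-)$, $2'=(+1,T/2,-,-)$; third position: $\mathrm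 m=(+1,0,-,+)$, $\mathrm a=(+1,T/2,-,+)$, $2=(-1,t,+,-)$; fourth position: $\mathrm m=(+1,0,+,-)$, $\mathrm a=(+1,T/2,+,-)$, $2=(-1,t,-,+)$, $\tilde 2=(-1,t,-,-)$ (with $t$ some real number). A frieze is of the type with a given label if $G$ is generated by its translations and symmetries of the kinds shown by the symbols in the label. If several symbols with $s=-1$ appear, they arise from one another by composition with elements with $s=+1$, so only one of them together with the symbols with $s=+1$ need be taken as generators. The 31 types are: $\mathrm{p111}$, $\mathrm{pm11}$, $\mathrm{p112}$, $\mathrm{p121}$, $\mathrm{p}11\tilde2$, $\mathrm{p1m1}$, $\mathrm{pmm2}$, $\mathrm{p}1\stackrel{2}{\mathrm m}1$, $\mathrm{p1a1}$, $\mathrm{pma2}$, $\mathrm{p}1\stackrel{2}{\mathrm a}1$, $\mathrm{p11m}$, $\mathrm{pm2m}$, $\mathrm{p}11\stackrel{2}{\mathrm m}$, $\mathrm{p11a}$, $\mathrm{pm2a}$, $\mathrm{p}11\stackrel{2}{\mathrm a}$, $\mathrm{p211}$, $\mathrm{p}\stackrel{2}{\mathrm m}11$, $\mathrm{p222}$, $\mathrm{p}2'11$, $\mathrm{p}\stackrel{2'}{\mathrm m}11$, $\mathrm{p}2'22$, $\mathrm{p2mm}$, $\mathrm{pmmm}$, $\mathrm{p}2'\mathrm{am}$, $\mathrm{pmam}$, $\mathrm{p}2'\mathrm{ma}$, $\mathrm{pmma}$, $\mathrm{p2aa}$, $\mathrm{pmaa}$ (in $\mathrm{pmmm}$, $\mathrm{pmam}$,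 $\mathrm{pmma}$, $\mathrm{pmaa}$ the three displayed symbols generate, with the translations, the whole group). A type is realised in hitomezashi if some hitomezashi two-sided frieze is of that type. *)

theory Defs
  imports Complex_Main "HOL-Algebra.Generated_Groups"
begin

text \<open>Binary digits are Booleans, with \<^term>\<open>True\<close> for 1. A unit edge is the set of points
  of a closed unit segment of the plane, so that isometries with arbitrary real translation
  parts act on edges by taking images.\<close>

definition vedge :: "int \<Rightarrow> nat \<Rightarrow> (real \<times> real) set" where
  "vedge i j = {of_int i} \<times> {real j .. real j + 1}"

definition hedge :: "int \<Rightarrow> nat \<Rightarrow> (real \<times> real) set" where
  "hedge i j = {of_int i .. of_int i + 1} \<times> {real j}"

definition grid_edges :: "nat \<Rightarrow> (real \<times> real) set set" where
  "grid_edges n = {vedge i j | i j. 1 \<le> j \<and> j \<le> n - 1} \<union> {hedge i j | i j. 1 \<le> j \<and> j \<le> n}"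

definition periodic_word :: "(int \<Rightarrow> bool) \<Rightarrow> bool" where
  "periodic_word x \<longleftrightarrow> (\<exists>w. w \<noteq> [] \<and> (\<forall>i. x i = w ! nat (i mod int (length w))))"

text \<open>The letter $y_j$ of the word $y = y_1 \cdots y_n$ is \<^term>\<open>y ! (j - 1)\<close>.\<close>

definition front_stitches :: "(int \<Rightarrow> bool) \<Rightarrow> bool list \<Rightarrow> (real \<times> real) set set" where
  "front_stitches x y =
     {vedge i j | i j. 1 \<le> j \<and> j \<le> length y - 1 \<and> (x i \<and> odd j \<or> \<not> x i \<and> even j)} \<union>
     {hedge i j | i j. 1 \<le> j \<and> j \<le> length y \<and>
        (y ! (j - 1) \<and> even i \<or> \<not> y ! (j - 1) \<and> odd i)}"

definition back_stitches :: "(int \<Rightarrow> bool) \<Rightarrow> bool list \<Rightarrow> (real \<times> real) set set" where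
  "back_stitches x y = grid_edges (length y) - front_stitches x y"

type_synonym isometry = "int \<times> real \<times> int \<times> int"

text \<open>The product is composition, the right factor acting first.\<close>

definition isometries :: "isometry monoid" where
  "isometries =
     \<lparr>carrier = {(s, t, e, d). s \<in> {1, -1} \<and> e \<in> {1, -1} \<and> d \<in> {1, -1}},
      mult = (\<lambda>(s, t, e, d) (s', t', e', d'). (s * s', of_int s * t' + t, e * e', d * d')),
      one = (1, 0, 1, 1)\<rparr>"

definition planar :: "nat \<Rightarrow> isometry \<Rightarrow> real \<times> real \<Rightarrow> real \<times> real" where
  "planar n = (\<lambda>(s, t, e, d) (X, Y). (of_int s * X + t, if e = 1 then Y else real n + 1 - Y))"

definition symmetries ::
  "nat \<Rightarrow> (real \<times> real) set set \<Rightarrow> (real \<times> real) set set \<Rightarrow> isometry set" where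
  "symmetries n F B = {(s, t, e, d) \<in> carrier isometries.
     (let edge_map = (\<lambda>E. planar n (s, t, e, d) ` E) in
      if d = 1 then edge_map ` F = F \<and> edge_map ` B = B
      else edge_map ` F = B \<and> edge_map ` B = F)}"

definition pure_translations ::
  "nat \<Rightarrow> (real \<times> real) set set \<Rightarrow> (real \<times> real) set set \<Rightarrow> isometry set" where
  "pure_translations n F B = {(1, t, 1, 1) | t. (1, t, 1, 1) \<in> symmetries n F B}"

definition translation_unit ::
  "nat \<Rightarrow> (real \<times> real) set set \<Rightarrow> (real \<times> real) set set \<Rightarrow> real \<Rightarrow> bool" where
  "translation_unit n F B T \<longleftrightarrow>
     T > 0 \<and> pure_translations n F B = {(1, of_int k * T, 1, 1) | k :: int. True}"

text \<open>\<^term>\<open>Mirror\<close>, \<open>Glide\<close>, \<open>Rot\<close>, \<open>Screw\<close> and \<open>Rotorefl\<close> stand for the symbols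
  m, a, 2, 2' and 2 with a tilde.\<close>

datatype frieze_symbol = Mirror | Glide | Rot | Screw | Rotorefl

datatype axis = Axis_a | Axis_b | Axis_c

text \<open>The three arguments of \<open>Label\<close> are the second, third and fourth positions of
  p***: the placeholder 1 is the empty set, and stacked symbols form a two-element set.\<close>

datatype label =
  Label (second: "frieze_symbol set") (third: "frieze_symbol set") (fourth: "frieze_symbol set")

fun position :: "label \<Rightarrow> axis \<Rightarrow> frieze_symbol set" where
  "position L Axis_a = second L"
| "position L Axis_b = third L"
| "position L Axis_c = fourth L"

text \<open>Isometries of the kind shown by a symbol at an axis, where \<open>T\<close> is the least translation
  length; the last equation covers the symbols that do not occur at the given axis.\<close>

fun kind :: "real \<Rightarrow> axis \<Rightarrow> frieze_symbol \<Rightarrow> isometry set" where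
  "kind T Axis_a Mirror = {(-1, t, 1, 1) | t. True}"
| "kind T Axis_a Rot = {(1, 0, -1, -1)}"
| "kind T Axis_a Screw = {(1, T / 2, -1, -1)}"
| "kind T Axis_b Mirror = {(1, 0, -1, 1)}"
| "kind T Axis_b Glide = {(1, T / 2, -1, 1)}"
| "kind T Axis_b Rot = {(-1, t, 1, -1) | t. True}"
| "kind T Axis_c Mirror = {(1, 0, 1, -1)}"
| "kind T Axis_c Glide = {(1, T / 2, 1, -1)}"
| "kind T Axis_c Rot = {(-1, t, -1, 1) | t. True}"
| "kind T Axis_c Rotorefl = {(-1, t, -1, -1) | t. True}"
| "kind T _ _ = {}"

text \<open>Every symbol of the label must be shown by an actual symmetry. Two symmetries of the same
  kind differ by a pure translation, so admitting all symmetries of each kind as generators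
  is the same as choosing one of each kind.\<close>

definition has_type ::
  "nat \<Rightarrow> (real \<times> real) set set \<Rightarrow> (real \<times> real) set set \<Rightarrow> label \<Rightarrow> bool" where
  "has_type n F B L \<longleftrightarrow> (\<exists>T. translation_unit n F B T \<and>
     (\<forall>p. \<forall>\<sigma> \<in> position L p. kind T p \<sigma> \<inter> symmetries n F B \<noteq> {}) \<and>
     symmetries n F B = generate isometries
       (pure_translations n F B \<union> (\<Union>p. \<Union>\<sigma> \<in> position L p. kind T p \<sigma> \<inter> symmetries n F B)))"

definition realised :: "label \<Rightarrow> bool" where
  "realised L \<longleftrightarrow> (\<exists>x y. periodic_word x \<and> length y \<ge> 2 \<and>
     has_type (length y) (front_stitches x y) (back_stitches x y) L)"

definition frieze_types :: "label set" where
  "frieze_types = {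
     Label {} {} {},
     Label {Mirror} {} {},
     Label {} {} {Rot},
     Label {} {Rot} {},
     Label {} {} {Rotorefl},
     Label {} {Mirror} {},
     Label {Mirror} {Mirror} {Rot},
     Label {} {Mirror, Rot} {},
     Label {} {Glide} {},
     Label {Mirror} {Glide} {Rot},
     Label {} {Glide, Rot} {},
     Label {} {} {Mirror},
     Label {Mirror} {Rot} {Mirror},
     Label {} {} {Mirror, Rot},
     Label {} {} {Glide},
     Label {Mirror} {Rot} {Glide},
     Label {} {} {Glide, Rot},
     Label {Rot} {} {},
     Label {Mirror, Rot} {} {},
     Label {Rot} {Rot} {Rot},
     Label {Screw} {} {},
     Label {Mirror, Screw} {} {},
     Label {Screw} {Rot} {Rot},
     Label {Rot} {Mirror} {Mirror},
     Label {Mirror} {Mirror} {Mirror},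
     Label {Screw} {Glide} {Mirror},
     Label {Mirror} {Glide} {Mirror},
     Label {Screw} {Mirror} {Glide},
     Label {Mirror} {Mirror} {Glide},
     Label {Rot} {Glide} {Glide},
     Label {Mirror} {Glide} {Glide}}"

lemma carrier_isometries:
  "(s, t, e, d) \<in> carrier isometries \<longleftrightarrow> s \<in> {1, -1} \<and> e \<in> {1, -1} \<and> d \<in> {1, -1}"
  by (simp add: isometries_def)

lemma mult_isometries:
  "(s, t, e, d) \<otimes>\<^bsub>isometries\<^esub> (s', t', e', d') = (s * s', of_int s * t' + t, e * e', d * d')"
  by (simp add: isometries_def)

lemma one_isometries: "\<one>\<^bsub>isometries\<^esub> = (1, 0, 1, 1)"
  by (simp add: isometries_def)

lemma group_isometries: "group isometries"
proof (rule groupI)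
  fix g h assume "g \<in> carrier isometries" "h \<in> carrier isometries"
  then show "g \<otimes>\<^bsub>isometries\<^esub> h \<in> carrier isometries"
    by (cases g; cases h) (auto simp: carrier_isometries mult_isometries)
next
  fix g h k
  show "g \<otimes>\<^bsub>isometries\<^esub> h \<otimes>\<^bsub>isometries\<^esub> k = g \<otimes>\<^bsub>isometries\<^esub> (h \<otimes>\<^bsub>isometries\<^esub> k)"
    by (cases g; cases h; cases k) (simp add: mult_isometries distrib_left mult.assoc add.assoc)
next
  fix g assume "g \<in> carrier isometries"
  then obtain s t e d where g: "g = (s, t, e, d)" "s \<in> {1, -1}" "e \<in> {1, -1}" "d \<in> {1, -1}"
    by (cases g) (auto simp: carrier_isometries)
  then have "(s, - of_int s * t, e, d) \<otimes>\<^bsub>isometries\<^esub> g = \<one>\<^bsub>isometries\<^esub>"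
    by (auto simp: mult_isometries one_isometries)
  with g show "\<exists>h \<in> carrier isometries. h \<otimes>\<^bsub>isometries\<^esub> g = \<one>\<^bsub>isometries\<^esub>"
    by (intro bexI) (auto simp: carrier_isometries)
next
  fix g show "\<one>\<^bsub>isometries\<^esub> \<otimes>\<^bsub>isometries\<^esub> g = g"
    by (cases g) (simp add: mult_isometries one_isometries)
qed (simp add: carrier_isometries one_isometries)

lemma planar_mult:
  assumes "g \<in> carrier isometries" "h \<in> carrier isometries"
  shows "planar n (g \<otimes>\<^bsub>isometries\<^esub> h) = planar n g \<circ> planar n h"
proof -
  obtain s t e d s' t' e' d' where gh: "g = (s, t, e, d)" "h = (s', t', e', d')"
    by (cases g; cases h) blast
  have "e \<in> {1, -1}" "e' \<in> {1, -1}" using assms by (simp_all add: gh carrier_isometries)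
  then have "planar n (g \<otimes>\<^bsub>isometries\<^esub> h) p = planar n g (planar n h p)" for p
    by (cases p) (auto simp: gh mult_isometries planar_def distrib_left mult.assoc)
  then show ?thesis by (simp add: fun_eq_iff)
qed

lemma planar_one: "planar n \<one>\<^bsub>isometries\<^esub> = id"
  by (simp add: one_isometries planar_def fun_eq_iff)

lemma subgroup_symmetries: "subgroup (symmetries n F B) isometries"
proof -
  interpret group isometries by (rule group_isometries)
  have img: "(\<lambda>E. planar n (g \<otimes>\<^bsub>isometries\<^esub> h) ` E) ` A =
      (\<lambda>E. planar n g ` E) ` (\<lambda>E. planar n h ` E) ` A"
    if "g \<in> carrier isometries" "h \<in> carrier isometries" for g h A
    unfolding planar_mult[OF that] by (simp add: image_comp comp_def)
  have img_one: "(\<lambda>E. planar n \<one>\<^bsub>isometries\<^esub> ` E) ` A = A" for A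
    by (simp add: planar_one)
  have img_inv: "(\<lambda>E. planar n (inv\<^bsub>isometries\<^esub> g) ` E) ` A' = A"
    if "g \<in> carrier isometries" "(\<lambda>E. planar n g ` E) ` A = A'" for g A A'
    using img[of "inv\<^bsub>isometries\<^esub> g" g A] img_one[of A] that by simp
  define side :: "isometry \<Rightarrow> int" where "side = (\<lambda>(s, t, e, d). d)"
  have side_mult: "side (g \<otimes>\<^bsub>isometries\<^esub> h) = side g * side h"
    for g h by (cases g; cases h) (simp add: side_def isometries_def)
  have side_pm: "side g = 1 \<or> side g = -1" if "g \<in> carrier isometries" for g
    using that by (auto simp: side_def isometries_def)
  have side_one: "side \<one>\<^bsub>isometries\<^esub> = 1" by (simp add: side_def isometries_def)
  have side_inv: "side (inv\<^bsub>isometries\<^esub> g) = side g" if "g \<in> carrier isometries" for g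
    using side_mult[of "inv\<^bsub>isometries\<^esub> g" g] side_pm[of g] side_pm[of "inv\<^bsub>isometries\<^esub> g"]
      that side_one by auto
  have sym_iff: "g \<in> symmetries n F B \<longleftrightarrow> g \<in> carrier isometries \<and>
      (if side g = 1 then (\<lambda>E. planar n g ` E) ` F = F \<and> (\<lambda>E. planar n g ` E) ` B = B
       else (\<lambda>E. planar n g ` E) ` F = B \<and> (\<lambda>E. planar n g ` E) ` B = F)" for g
    by (cases g) (simp add: symmetries_def side_def Let_def)
  show ?thesis
  proof (rule subgroup.intro)
    show "symmetries n F B \<subseteq> carrier isometries" by (auto simp: sym_iff)
    show "\<one>\<^bsub>isometries\<^esub> \<in> symmetries n F B" by (simp add: sym_iff side_one img_one)
  next
    fix g h assume "g \<in> symmetries n F B" "h \<in> symmetries n F B"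
    then show "g \<otimes>\<^bsub>isometries\<^esub> h \<in> symmetries n F B"
      using side_pm[of g] side_pm[of h]
      by (auto simp: sym_iff side_mult img split: if_splits)
  next
    fix g assume g: "g \<in> symmetries n F B"
    then have gc: "g \<in> carrier isometries" by (simp add: sym_iff)
    show "inv\<^bsub>isometries\<^esub> g \<in> symmetries n F B"
    proof (cases "side g = 1")
      case True
      then have "(\<lambda>E. planar n g ` E) ` F = F" "(\<lambda>E. planar n g ` E) ` B = B"
        using g by (simp_all add: sym_iff)
      from this[THEN img_inv[OF gc]] show ?thesis
        using True gc by (simp add: sym_iff side_inv)
    next
      case False
      then have "(\<lambda>E. planar n g ` E) ` F = B" "(\<lambda>E. planar n g ` E) ` B = F"
        using g by (simp_all add: sym_iff)
      from this[THEN img_inv[OF gc]] show ?thesis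
        using False gc by (simp add: sym_iff side_inv)
    qed
  qed
qed

lemma planar_shift: "planar n (1, of_int k, 1, 1) ` (A \<times> C) = (\<lambda>X. X + of_int k) ` A \<times> C"
proof -
  have "planar n (1, of_int k, 1, 1) = map_prod (\<lambda>X. X + of_int k) id"
    by (simp add: planar_def fun_eq_iff)
  then show ?thesis by (force simp: image_iff)
qed

lemma planar_shift_vedge: "planar n (1, of_int k, 1, 1) ` vedge i j = vedge (i + k) j"
  unfolding vedge_def planar_shift by simp

lemma planar_shift_hedge: "planar n (1, of_int k, 1, 1) ` hedge i j = hedge (i + k) j"
  unfolding hedge_def planar_shift image_add_atLeastAtMost' by (simp add: algebra_simps)

lemma shift_front_subset:
  assumes "\<And>i. x (i + k) = x i" "even k"
  shows "(\<lambda>E. planar n (1, of_int k, 1, 1) ` E) ` front_stitches x y \<subseteq> front_stitches x y"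
proof (rule image_subsetI)
  fix E assume "E \<in> front_stitches x y"
  then consider
    (v) i j where "E = vedge i j" "1 \<le> j" "j \<le> length y - 1" "x i \<and> odd j \<or> \<not> x i \<and> even j"
  | (h) i j where "E = hedge i j" "1 \<le> j" "j \<le> length y"
      "y ! (j - 1) \<and> even i \<or> \<not> y ! (j - 1) \<and> odd i"
    unfolding front_stitches_def by blast
  then show "planar n (1, of_int k, 1, 1) ` E \<in> front_stitches x y"
  proof cases
    case v
    then have "x (i + k) \<and> odd j \<or> \<not> x (i + k) \<and> even j" using assms(1) by simp
    then show ?thesis
      unfolding v(1) planar_shift_vedge front_stitches_def using v(2,3) by blast
  next
    case h
    then have "y ! (j - 1) \<and> even (i + k) \<or> \<not> y ! (j - 1) \<and> odd (i + k)"
      using assms(2) by simp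
    then show ?thesis
      unfolding h(1) planar_shift_hedge front_stitches_def using h(2,3) by blast
  qed
qed

lemma shift_grid_subset:
  "(\<lambda>E. planar n (1, of_int k, 1, 1) ` E) ` grid_edges m \<subseteq> grid_edges m"
proof (rule image_subsetI)
  fix E assume "E \<in> grid_edges m"
  then consider (v) i j where "E = vedge i j" "1 \<le> j" "j \<le> m - 1"
    | (h) i j where "E = hedge i j" "1 \<le> j" "j \<le> m"
    unfolding grid_edges_def by blast
  then show "planar n (1, of_int k, 1, 1) ` E \<in> grid_edges m"
  proof cases
    case v
    show ?thesis unfolding v(1) planar_shift_vedge grid_edges_def using v(2,3) by blast
  next
    case h
    show ?thesis unfolding h(1) planar_shift_hedge grid_edges_def using h(2,3) by blast
  qed
qed

lemma shift_symmetry: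
  fixes k :: int
  assumes "\<And>i. x (i + k) = x i" "even k"
  shows "(1, of_int k, 1, 1) \<in> symmetries (length y) (front_stitches x y) (back_stitches x y)"
proof -
  let ?f = "\<lambda>k E. planar (length y) (1, of_int k, 1, 1) ` E"
  have inv: "?f k (?f (- k) E) = E" "?f (- k) (?f k E) = E" for E
    by (simp_all add: image_comp comp_def planar_def case_prod_beta)
  have eq: "?f k ` A = A" if "?f k ` A \<subseteq> A" "?f (- k) ` A \<subseteq> A" for A
  proof
    show "A \<subseteq> ?f k ` A"
    proof
      fix E assume "E \<in> A"
      then have "?f (- k) E \<in> A" using that(2) by blast
      then show "E \<in> ?f k ` A" using inv(1)[of E] by (metis image_eqI)
    qed
  qed (fact that(1))
  have m: "x (i + - k) = x i" for i using assms(1)[of "i - k"] by simp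
  have F: "?f k ` front_stitches x y = front_stitches x y"
    using assms m by (intro eq shift_front_subset) simp_all
  have G: "?f k ` grid_edges (length y) = grid_edges (length y)"
    by (intro eq shift_grid_subset)
  have "inj (?f k)" by (rule injI) (metis inv(2))
  then have "?f k ` back_stitches x y = back_stitches x y"
    unfolding back_stitches_def by (simp add: image_set_diff F G)
  then show ?thesis using F by (simp add: symmetries_def isometries_def Let_def)
qed

text \<open>The pure translations in the symmetry group form a group generated by one translation,
  so the existential over \<open>T\<close> in \<open>has_type\<close> imposes no condition.\<close>

lemma ex_translation_unit:
  assumes x: "periodic_word x" and y: "length y \<ge> 2"
  shows "\<exists>T. translation_unit (length y) (front_stitches x y) (back_stitches x y) T"
proof -
  define S where "S = symmetries (length y) (front_stitches x y) (back_stitches x y)"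
  define K where "K = {k :: int. (1, of_int k, 1, 1) \<in> S}"
  interpret subgroup S isometries unfolding S_def by (rule subgroup_symmetries)
  have integral: "\<exists>k :: int. t = of_int k" if "(1, t, 1, 1) \<in> S" for t
  proof -
    have "vedge 0 1 \<in> grid_edges (length y)" using y unfolding grid_edges_def by fastforce
    then have "vedge 0 1 \<in> front_stitches x y \<union> back_stitches x y"
      by (auto simp: back_stitches_def)
    then have "planar (length y) (1, t, 1, 1) ` vedge 0 1 \<in> front_stitches x y \<union> back_stitches x y"
      using that unfolding S_def symmetries_def Let_def by auto
    moreover have "front_stitches x y \<union> back_stitches x y \<subseteq> grid_edges (length y)"
      unfolding back_stitches_def grid_edges_def front_stitches_def by blast
    ultimately have "planar (length y) (1, t, 1, 1) ` vedge 0 1 \<in> grid_edges (length y)" by blast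
    moreover have "(t, 1) \<in> planar (length y) (1, t, 1, 1) ` vedge 0 1"
      "(t, 2) \<in> planar (length y) (1, t, 1, 1) ` vedge 0 1"
      by (auto simp: planar_def vedge_def image_iff)
    moreover have "(t, 1) \<in> hedge i j \<Longrightarrow> (t, 2) \<in> hedge i j \<Longrightarrow> False" for i j
      by (auto simp: hedge_def)
    moreover have "(t, 1) \<in> vedge i j \<Longrightarrow> t = of_int i" for i j
      by (auto simp: vedge_def)
    ultimately show ?thesis unfolding grid_edges_def by blast
  qed
  have add: "a + b \<in> K" if "a \<in> K" "b \<in> K" for a b
  proof -
    have "(1, of_int a, 1, 1) \<otimes>\<^bsub>isometries\<^esub> (1, of_int b, 1, 1) \<in> S"
      using that by (intro m_closed) (simp_all add: K_def)
    then show ?thesis by (simp add: K_def isometries_def add.commute)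
  qed
  have neg: "- a \<in> K" if "a \<in> K" for a
  proof -
    interpret group isometries by (rule group_isometries)
    have "inv\<^bsub>isometries\<^esub> (1, of_int a, 1, 1) = (1, of_int (- a), 1, 1)"
      by (rule inv_equality) (simp_all add: isometries_def)
    then show ?thesis using m_inv_closed[of "(1, of_int a, 1, 1)"] that by (simp add: K_def)
  qed
  have zero: "0 \<in> K" using one_closed by (simp add: K_def isometries_def)
  have mult_nat: "int m * a \<in> K" if "a \<in> K" for m a
    by (induction m) (use zero add that in \<open>auto simp: distrib_right\<close>)
  have mult: "m * a \<in> K" if "a \<in> K" for m a
  proof (cases "m \<ge> 0")
    case True
    then show ?thesis using mult_nat[OF that, of "nat m"] by simp
  next
    case False
    then show ?thesis using neg[OF mult_nat[OF that, of "nat (- m)"]] by simp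
  qed
  obtain w where w: "w \<noteq> []" "\<And>i. x i = w ! nat (i mod int (length w))"
    using x unfolding periodic_word_def by blast
  have "x (i + 2 * int (length w)) = x i" for i by (simp add: w(2))
  then have "2 * int (length w) \<in> K"
    using shift_symmetry[of x "2 * int (length w)" y] by (simp add: K_def S_def)
  then have ex: "\<exists>k. k > 0 \<and> int k \<in> K"
    using w(1) by (intro exI[of _ "2 * length w"]) simp
  define q where "q = (LEAST k. k > 0 \<and> int k \<in> K)"
  have q: "q > 0" "int q \<in> K" using LeastI_ex[OF ex] by (auto simp: q_def)
  have "int q dvd k" if "k \<in> K" for k
  proof (rule ccontr)
    assume "\<not> int q dvd k"
    then have pos: "k mod int q > 0"
      using q(1) by (metis dvd_eq_mod_eq_0 of_nat_0_less_iff order_le_less pos_mod_sign)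
    have "k mod int q = k + - (k div int q) * int q"
      by (simp add: minus_div_mult_eq_mod [symmetric])
    then have "k mod int q \<in> K" using add[OF that mult[OF q(2)]] by metis
    then have "q \<le> nat (k mod int q)"
      using pos unfolding q_def by (intro Least_le) (simp add: q_def [symmetric])
    moreover have "k mod int q < int q" using q(1) by simp
    ultimately show False using pos by linarith
  qed
  then have K: "K = {k * int q | k. True}"
    using mult[OF q(2)] by (auto simp: dvd_def mult.commute)
  have "pure_translations (length y) (front_stitches x y) (back_stitches x y)
      = {(1, of_int k, 1, 1) | k. k \<in> K}"
    using integral by (auto simp: pure_translations_def K_def S_def)
  also have "\<dots> = {(1, of_int k * real q, 1, 1) | k :: int. True}"
  proof -
    have eq: "real_of_int k * real q = of_int (k * int q)" for k by simp
    show ?thesis unfolding K eq by blast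
  qed
  finally show ?thesis using q(1) unfolding translation_unit_def by (intro exI[of _ "real q"]) simp
qed

end

theory Submission imports Defs begin

text \<open>The symbol m in the fourth position stands for reflection in the frieze plane itself. This
  reflection moves no point of the plane and exchanges the two sides, so it is a symmetry only if
  the edges stitched on the front are exactly the edges stitched on the back. But stitches and gaps
  swap between the sides, so that every edge is stitched on exactly one side.\<close>

lemma frieze_plane_reflection_iff:
  "(1, 0, 1, -1) \<in> symmetries n F B \<longleftrightarrow> F = B"
proof -
  have "planar n (1, 0, 1, -1) = id"
    by (simp add: planar_def fun_eq_iff)
  then show ?thesis
    by (auto simp: symmetries_def isometries_def Let_def)
qed

lemma front_neq_back:
  assumes "y \<noteq> []"
  shows "front_stitches x y \<noteq> back_stitches x y"
proof
  assume "front_stitches x y = back_stitches x y"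
  then have "grid_edges (length y) = {}"
    unfolding back_stitches_def by blast
  moreover have "hedge 0 1 \<in> grid_edges (length y)"
    using assms unfolding grid_edges_def by (fastforce simp: Suc_le_eq)
  ultimately show False by blast
qed

lemma not_realised_if_frieze_plane_mirror:
  assumes "Mirror \<in> fourth L"
  shows "\<not> realised L"
proof
  assume "realised L"
  then obtain x y T where y: "length y \<ge> 2"
    and kinds: "\<forall>p. \<forall>\<sigma> \<in> position L p.
      kind T p \<sigma> \<inter> symmetries (length y) (front_stitches x y) (back_stitches x y) \<noteq> {}"
    unfolding realised_def has_type_def by blast
  have "kind T Axis_c Mirror \<inter>
      symmetries (length y) (front_stitches x y) (back_stitches x y) \<noteq> {}"
    using kinds[rule_format, of Mirror Axis_c] assms by simp
  then have "front_stitches x y = back_stitches x y"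
    by (simp add: frieze_plane_reflection_iff)
  moreover have "y \<noteq> []" using y by auto
  ultimately show False using front_neq_back by blast
qed

theorem theorem1:
  "(\<forall>L \<in> frieze_types. Mirror \<in> fourth L \<longrightarrow> \<not> realised L) \<and>
   {L \<in> frieze_types. Mirror \<in> fourth L} =
     {Label {} {} {Mirror},
      Label {} {} {Mirror, Rot},
      Label {Rot} {Mirror} {Mirror},
      Label {Mirror} {Rot} {Mirror},
      Label {Mirror} {Mirror} {Mirror},
      Label {Screw} {Glide} {Mirror},
      Label {Mirror} {Glide} {Mirror}}"
proof (intro conjI ballI impI)
  show "\<not> realised L" if "Mirror \<in> fourth L" for L
    using that by (rule not_realised_if_frieze_plane_mirror)
next
  \<comment> \<open>Filtering the enumeration of types one label at a time avoids the large case distinction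
    over labels of an elementwise proof.\<close>
  have filter_insert: "{L \<in> insert M A. Mirror \<in> fourth L} =
      (if Mirror \<in> fourth M then insert M else id) {L \<in> A. Mirror \<in> fourth L}" for M A
    by auto
  show "{L \<in> frieze_types. Mirror \<in> fourth L} =
     {Label {} {} {Mirror},
      Label {} {} {Mirror, Rot},
      Label {Rot} {Mirror} {Mirror},
      Label {Mirror} {Rot} {Mirror},
      Label {Mirror} {Mirror} {Mirror},
      Label {Screw} {Glide} {Mirror},
      Label {Mirror} {Glide} {Mirror}}"
    unfolding frieze_types_def filter_insert by (simp add: insert_commute)
qed

end
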